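(* Let $n\geq 2$ be an integer, and let $K(n) = (n-1)^2+3$ if $n$ is even and $K(n) = (n-1)^2+2$ if $n$ is odd. Then $K(n)$ is the smallest integer $K$ such that the recurrence $$a_n(k) = 2a_n(k-1)-2a_n(k-3)+a_n(k-4)$$ holds for all integers $k\geq 4$ with $k > K$. Moreover, for $k=K(n)$, $$a_n(k) = 2a_n(k-1)-2a_n(k-3)+a_n(k-4)-4.$$
   Context: For integers $n\geq 1$ and $k\geq 0$, the $n$ by $k$ grid is the set of points $\{1,\dots,n\}\times\{1,\dots,k\}\subset\mathbb{R}^2$ (empty if $k=0$, so that $a_n(0)=0$). $a_n(k)$ denotes the number of isosceles triangles of nonzero area formed by 3 distinct points of the $n$ by $k$ grid, i.e. the number of 3-element subsets of the grid that are non-collinear and are the vertices of a triangle having at least two sides of equal Euclidean length. *)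

theory Defs
  imports "HOL-Analysis.Analysis"
begin

(* The metric on real \<times> real is the Euclidean one (dist_prod_def). *)
definition grid :: "nat \<Rightarrow> nat \<Rightarrow> (real \<times> real) set" where
  "grid n k = (\<lambda>(i, j). (real i, real j)) ` ({1..n} \<times> {1..k})"

(* Triangles are vertex sets. The points x, y, z are distinct because card T = 3,
   and the sides of equal length are those meeting at x. *)
definition isosceles_triangle :: "(real \<times> real) set \<Rightarrow> bool" where
  "isosceles_triangle T \<longleftrightarrow>
     card T = 3 \<and> \<not> collinear T \<and> (\<exists>x y z. T = {x, y, z} \<and> dist x y = dist x z)"

definition num_isosceles :: "nat \<Rightarrow> nat \<Rightarrow> nat" where
  "num_isosceles n k = card {T. T \<subseteq> grid n k \<and> isosceles_triangle T}"

(* Integer-valued, so that the subtractions in the recurrence are not truncated. *)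
abbreviation a_int :: "nat \<Rightarrow> nat \<Rightarrow> int" where
  "a_int n k \<equiv> int (num_isosceles n k)"

definition K_bound :: "nat \<Rightarrow> nat" where
  "K_bound n = (if even n then (n - 1)\<^sup>2 + 3 else (n - 1)\<^sup>2 + 2)"

definition recurrence_beyond :: "nat \<Rightarrow> int \<Rightarrow> bool" where
  "recurrence_beyond n K \<longleftrightarrow>
     (\<forall>k::nat. k \<ge> 4 \<and> int k > K \<longrightarrow>
        a_int n k = 2 * a_int n (k - 1) - 2 * a_int n (k - 3) + a_int n (k - 4))"

end

theory Submission
  imports Defs
begin

text \<open>
  A lattice triangle is never equilateral, so an isosceles triangle in the grid has exactly one
  apex, and twice the number of triangles is the number of ordered triples (apex, foot, foot).
  Let \<open>t(k)\<close> be the number of such triples in the \<open>n\<close> by \<open>k\<close> grid that meet both the bottom and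
  the top row. Because the count is invariant under vertical translation, \<open>t\<close> is the second
  difference of the number of triples. The characteristic polynomial of the recurrence is
  \<open>x^4 - 2 x^3 + 2 x - 1 = (x - 1)^2 (x^2 - 1)\<close>, so the failure of the recurrence at \<open>k\<close> is exactly
  \<open>t(k) - t(k - 2)\<close>, counted in triples.

  The triples are split by the vertical rises \<open>p\<close> and \<open>q\<close> (in absolute value) of the two legs.
  If \<open>p = q\<close>, the triangle is symmetric about a horizontal or a vertical line, and stretching it by
  two rows is a bijection (\<open>card_balanced_step\<close>); these triangles do not contribute to the failure.
  If \<open>p > q\<close>, let \<open>A\<close> and \<open>B\<close> be the horizontal runs of the flatter and of the steeper leg and
  \<open>m = n - 1\<close>. Equality of the legs says \<open>(p - q) (p + q) = A^2 - B^2 \<le> m^2\<close>, while a triangle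
  that meets the rows \<open>1\<close> and \<open>k\<close> has \<open>p + q \<ge> k - 1\<close>. Hence \<open>k - 1 \<le> m^2\<close>, and such triangles do
  not exist in tall grids. Since \<open>p + q\<close> and \<open>p - q\<close> have the same parity, the largest value of
  \<open>k - 1\<close> that occurs is \<open>m^2\<close> for odd \<open>m\<close> (with \<open>A = m\<close>, \<open>B = 0\<close>) and \<open>m^2 - 1\<close> for even \<open>m\<close>
  (with \<open>A = m\<close>, \<open>B = 1\<close>). In both cases \<open>p - q = 1\<close>, and the triangle is determined up to the
  reflections in the two axes of the grid (\<open>card_steep_critical\<close>). This extremal \<open>k\<close> is \<open>K(n) - 2\<close>: from the term
  \<open>- t(k - 2)\<close> come the four missing triangles at \<open>k = K(n)\<close>, and nothing fails beyond.
\<close>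

section \<open>From triangles to apex-marked triples\<close>

type_synonym pt = "int \<times> int"

fun sqdist :: "pt \<Rightarrow> pt \<Rightarrow> int" where
  "sqdist (a, b) (c, d) = (c - a)\<^sup>2 + (d - b)\<^sup>2"

fun cross :: "pt \<Rightarrow> pt \<Rightarrow> pt \<Rightarrow> int" where
  "cross (a, b) (c, d) (e, f) = (c - a) * (f - b) - (d - b) * (e - a)"

definition isosceles_at :: "pt \<Rightarrow> pt \<Rightarrow> pt \<Rightarrow> bool" where
  "isosceles_at x y z \<longleftrightarrow> sqdist x y = sqdist x z \<and> cross x y z \<noteq> 0"

definition configs :: "int \<Rightarrow> int \<Rightarrow> (pt \<times> pt \<times> pt) set" where
  "configs n k = {(x, y, z). {x, y, z} \<subseteq> {1..n} \<times> {1..k} \<and> isosceles_at x y z}"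

lemma three_times_square_not_square:
  fixes a b :: int
  assumes "a\<^sup>2 = 3 * b\<^sup>2"
  shows "b = 0"
proof (rule ccontr)
  assume b: "b \<noteq> 0"
  have 3: "prime_elem (3::int)" by simp
  have "a \<noteq> 0" using assms b by auto
  then have "multiplicity 3 (a\<^sup>2) = 2 * multiplicity 3 a"
    using prime_elem_multiplicity_power_distrib[OF 3] by blast
  moreover have "multiplicity 3 (3 * b\<^sup>2) = 1 + 2 * multiplicity 3 b"
    using prime_elem_multiplicity_mult_distrib[OF 3, of 3 "b\<^sup>2"]
      prime_elem_multiplicity_power_distrib[OF 3 b, of 2] b by simp
  ultimately have "2 * multiplicity 3 a = 1 + 2 * multiplicity 3 b" using assms by simp
  then show False by presburger
qed

text \<open>
  For legs with squared length \<open>N\<close> and a third side of the same length, twice the inner product of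
  the legs is \<open>N\<close>, so Lagrange's identity makes \<open>3 N^2\<close> the square of twice the cross product.
\<close>

lemma no_equilateral:
  assumes "sqdist x y = sqdist x z" "sqdist y x = sqdist y z"
  shows "cross x y z = 0"
proof -
  obtain a b c d e f where xyz: "x = (a, b)" "y = (c, d)" "z = (e, f)"
    by (metis surj_pair)
  define p q r s where "p = c - a" "q = d - b" "r = e - a" "s = f - b"
  note defs = this
  have 1: "p\<^sup>2 + q\<^sup>2 = r\<^sup>2 + s\<^sup>2" and 2: "p\<^sup>2 + q\<^sup>2 = (r - p)\<^sup>2 + (s - q)\<^sup>2"
    using assms by (auto simp: xyz defs power2_commute)
  let ?N = "p\<^sup>2 + q\<^sup>2"
  have dot: "2 * (p * r + q * s) = ?N"
    using 1 2 by (simp add: power2_eq_square algebra_simps)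
  have "(2 * (p * s - q * r))\<^sup>2 = 4 * (?N * (r\<^sup>2 + s\<^sup>2)) - (2 * (p * r + q * s))\<^sup>2"
    by (simp add: power2_eq_square algebra_simps)
  also have "\<dots> = 3 * ?N\<^sup>2"
    unfolding dot 1[symmetric] by (simp add: power2_eq_square)
  finally have "?N = 0" by (rule three_times_square_not_square)
  then have "p = 0" "q = 0" by (simp_all add: sum_power2_eq_zero_iff)
  then show ?thesis by (simp add: xyz defs)
qed

fun emb :: "pt \<Rightarrow> real \<times> real" where
  "emb (i, j) = (real_of_int i, real_of_int j)"

lemma inj_emb: "inj emb"
  by (auto simp: inj_def)

lemma emb_eq_iff [simp]: "emb x = emb y \<longleftrightarrow> x = y"
  using inj_emb by (rule inj_eq)

lemma grid_eq_emb_image: "grid n k = emb ` ({1..int n} \<times> {1..int k})"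
proof -
  have "{1..int m} = int ` {1..m}" for m
    by (simp add: image_int_atLeastAtMost)
  then have "{1..int n} \<times> {1..int k} = (\<lambda>(i, j). (int i, int j)) ` ({1..n} \<times> {1..k})"
    by (auto simp: image_iff)
  then show ?thesis
    unfolding grid_def by (simp add: image_image case_prod_unfold)
qed

lemma dist_emb: "dist (emb x) (emb y) = sqrt (real_of_int (sqdist x y))"
  by (cases x; cases y) (simp add: dist_prod_def dist_real_def power2_commute)

lemma dist_emb_eq_iff: "dist (emb x) (emb y) = dist (emb x) (emb z) \<longleftrightarrow> sqdist x y = sqdist x z"
  by (simp add: dist_emb)

lemma collinear_emb_iff: "collinear {emb x, emb y, emb z} \<longleftrightarrow> cross x y z = 0"
proof -
  obtain a b c d e f where xyz: "x = (a, b)" "y = (c, d)" "z = (e, f)"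
    by (metis surj_pair)
  define p q r s where "p = real_of_int (c - a)" "q = real_of_int (d - b)"
    "r = real_of_int (e - a)" "s = real_of_int (f - b)"
  note defs = this
  have sub: "emb y - emb x = (p, q)" "emb z - emb x = (r, s)"
    by (auto simp: xyz defs)
  have "collinear {emb x, emb y, emb z} \<longleftrightarrow> collinear {emb y, emb x, emb z}"
    by (simp add: insert_commute)
  also have "\<dots> \<longleftrightarrow> collinear {0, (p, q), (r, s)}"
    by (simp add: collinear_3 sub)
  also have "\<dots> \<longleftrightarrow> p * s - q * r = 0"
  proof
    assume "collinear {0, (p, q), (r, s)}"
    then show "p * s - q * r = 0"
      unfolding collinear_lemma by (auto simp: zero_prod_def)
  next
    assume *: "p * s - q * r = 0"
    show "collinear {0, (p, q), (r, s)}"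
    proof (cases "p = 0")
      case True
      show ?thesis
      proof (cases "q = 0")
        case False
        with True * have "(r, s) = (s / q) *\<^sub>R (p, q)" by auto
        then show ?thesis unfolding collinear_lemma by blast
      next
        case True
        with \<open>p = 0\<close> show ?thesis by (simp add: zero_prod_def[symmetric])
      qed
    next
      case False
      with * have "(r, s) = (r / p) *\<^sub>R (p, q)" by (auto simp: field_simps)
      then show ?thesis unfolding collinear_lemma by blast
    qed
  qed
  also have "p * s - q * r = real_of_int (cross x y z)"
    by (simp add: xyz defs)
  finally show ?thesis by simp
qed

lemma cross_distinct:
  assumes "cross x y z \<noteq> 0"
  shows "x \<noteq> y" "x \<noteq> z" "y \<noteq> z"
  using assms by (cases x; cases y; cases z; auto)+

lemma cross_swap: "cross x z y = - cross x y z"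
  by (cases x; cases y; cases z) simp

lemma isosceles_at_swap: "isosceles_at x z y \<longleftrightarrow> isosceles_at x y z"
  unfolding isosceles_at_def cross_swap[of x z y] by auto

lemma isosceles_triangle_emb:
  assumes "isosceles_at x y z"
  shows "isosceles_triangle {emb x, emb y, emb z}"
proof -
  have "cross x y z \<noteq> 0" and "sqdist x y = sqdist x z"
    using assms by (auto simp: isosceles_at_def)
  then have "card {emb x, emb y, emb z} = 3" "\<not> collinear {emb x, emb y, emb z}"
    and "dist (emb x) (emb y) = dist (emb x) (emb z)"
    using cross_distinct[of x y z] collinear_emb_iff[of x y z] dist_emb_eq_iff[of x y z]
    by auto
  then show ?thesis
    unfolding isosceles_triangle_def by blast
qed

text \<open>
  An isosceles triangle with two possible apexes would be equilateral.
\<close>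

lemma apex_unique:
  assumes "isosceles_at x y z" "isosceles_at x' y' z'" "{x', y', z'} = {x, y, z}"
  shows "(x', y', z') = (x, y, z) \<or> (x', y', z') = (x, z, y)"
proof -
  have d: "x \<noteq> y" "x \<noteq> z" "y \<noteq> z" "x' \<noteq> y'" "x' \<noteq> z'" "y' \<noteq> z'"
    using assms(1,2) cross_distinct unfolding isosceles_at_def by metis+
  have mem: "x' \<in> {x, y, z}" "y' \<in> {x, y, z}" "z' \<in> {x, y, z}"
    unfolding assms(3)[symmetric] by simp_all
  have "x' \<noteq> y"
  proof
    assume "x' = y"
    with d mem have "(y' = x \<and> z' = z) \<or> (y' = z \<and> z' = x)" by auto
    then have "sqdist y x = sqdist y z"
      using assms(2) \<open>x' = y\<close> by (auto simp: isosceles_at_def)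
    with assms(1) show False
      using no_equilateral[of x y z] by (simp add: isosceles_at_def)
  qed
  moreover have "x' \<noteq> z"
  proof
    assume "x' = z"
    with d mem have "(y' = x \<and> z' = y) \<or> (y' = y \<and> z' = x)" by auto
    then have "sqdist z x = sqdist z y"
      using assms(2) \<open>x' = z\<close> by (auto simp: isosceles_at_def)
    with assms(1) show False
      using no_equilateral[of x z y] by (simp add: isosceles_at_def cross_swap[of x z y])
  qed
  ultimately have "x' = x" using mem by simp
  with d mem show ?thesis by auto
qed

lemma finite_configs: "finite (configs n k)"
  by (rule finite_subset[of _ "({1..n} \<times> {1..k}) \<times> ({1..n} \<times> {1..k}) \<times> ({1..n} \<times> {1..k})"])
     (auto simp: configs_def)

lemma card_configs: "card (configs (int n) (int k)) = 2 * num_isosceles n k"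
proof -
  let ?A = "{T. T \<subseteq> grid n k \<and> isosceles_triangle T}"
  let ?f = "\<lambda>(x, y, z). {emb x, emb y, emb z}"
  let ?F = "\<lambda>T. {c \<in> configs (int n) (int k). ?f c = T}"
  have fin: "finite ?A"
    by (rule finite_subset[of _ "Pow (grid n k)"]) (auto simp: grid_def)
  have maps: "?f c \<in> ?A" if "c \<in> configs (int n) (int k)" for c
  proof -
    obtain x y z where c: "c = (x, y, z)" by (metis surj_pair)
    show ?thesis
      using that isosceles_triangle_emb[of x y z]
      unfolding c grid_eq_emb_image configs_def by auto
  qed
  have "configs (int n) (int k) = (\<Union>T\<in>?A. ?F T)"
    using maps by auto
  also have "card \<dots> = (\<Sum>T\<in>?A. card (?F T))"
    using fin finite_configs by (intro card_UN_disjoint) auto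
  also have "\<dots> = (\<Sum>T\<in>?A. 2)"
  proof (rule sum.cong[OF refl])
    fix T assume T: "T \<in> ?A"
    then obtain x' y' z' where T': "T = {x', y', z'}" "dist x' y' = dist x' z'"
      by (auto simp: isosceles_triangle_def)
    then have "x' \<in> grid n k" "y' \<in> grid n k" "z' \<in> grid n k" using T by auto
    then obtain x y z where xyz: "x' = emb x" "y' = emb y" "z' = emb z"
      and sub: "{x, y, z} \<subseteq> {1..int n} \<times> {1..int k}"
      unfolding grid_eq_emb_image by (elim imageE) simp
    have iso: "isosceles_at x y z"
      using T T' collinear_emb_iff[of x y z] dist_emb_eq_iff[of x y z]
      by (auto simp: xyz isosceles_at_def isosceles_triangle_def)
    have Teq: "T = emb ` {x, y, z}" using T' xyz by simp
    have mem: "(x, y, z) \<in> ?F T" "(x, z, y) \<in> ?F T"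
      using iso sub isosceles_at_swap[of x y z] by (auto simp: Teq configs_def)
    have "?F T \<subseteq> {(x, y, z), (x, z, y)}"
    proof
      fix c assume c: "c \<in> ?F T"
      obtain u v w where uvw: "c = (u, v, w)" by (metis surj_pair)
      have "emb ` {u, v, w} = emb ` {x, y, z}" using c Teq uvw by simp
      then have "{u, v, w} = {x, y, z}" by (simp only: inj_image_eq_iff[OF inj_emb])
      moreover have "isosceles_at u v w" using c uvw by (simp add: configs_def)
      ultimately show "c \<in> {(x, y, z), (x, z, y)}"
        using apex_unique[OF iso] uvw by auto
    qed
    with mem have "?F T = {(x, y, z), (x, z, y)}" by blast
    moreover have "y \<noteq> z" using iso cross_distinct(3) unfolding isosceles_at_def by blast
    ultimately show "card (?F T) = 2" by simp
  qed
  finally show ?thesis by (simp add: num_isosceles_def)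
qed

section \<open>Second differences count the triangles spanning all rows\<close>

text \<open>
  The triples that the \<open>n\<close> by \<open>k\<close> grid has in addition to those of the \<open>n\<close> by \<open>k - 1\<close> grid are the
  ones that meet the top row. Of these, the ones that avoid the bottom row are translates of the
  corresponding triples for \<open>k - 1\<close>, so that only the spanning ones survive a second difference.
\<close>

definition topped :: "int \<Rightarrow> int \<Rightarrow> (pt \<times> pt \<times> pt) set" where
  "topped n k = {(x, y, z) \<in> configs n k. k \<in> {snd x, snd y, snd z}}"

definition spanning :: "int \<Rightarrow> int \<Rightarrow> (pt \<times> pt \<times> pt) set" where
  "spanning n k = {(x, y, z) \<in> topped n k. 1 \<in> {snd x, snd y, snd z}}"

lemma finite_topped: "finite (topped n k)"
  by (rule finite_subset[OF _ finite_configs[of n k]]) (auto simp: topped_def)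

lemma finite_spanning: "finite (spanning n k)"
  by (rule finite_subset[OF _ finite_topped[of n k]]) (auto simp: spanning_def)

lemma card_configs_diff: "card (configs n k) = card (configs n (k - 1)) + card (topped n k)"
proof -
  have "configs n k = configs n (k - 1) \<union> topped n k" "configs n (k - 1) \<inter> topped n k = {}"
    by (auto simp: configs_def topped_def)
  then show ?thesis
    using card_Un_disjoint finite_configs finite_topped by metis
qed

lemma card_topped_diff:
  assumes "k \<ge> 2"
  shows "card (topped n k) = card (topped n (k - 1)) + card (spanning n k)"
proof -
  let ?up = "\<lambda>((a, b), (c, d), (e, f)). ((a, b + 1), (c, d + 1), (e, f + 1)) :: pt \<times> pt \<times> pt"
  have inj: "inj_on ?up A" for A by (auto simp: inj_on_def)
  have "topped n k = ?up ` topped n (k - 1) \<union> spanning n k"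
  proof (intro equalityI subsetI)
    fix w assume w: "w \<in> topped n k"
    obtain a b c d e f where weq: "w = ((a, b), (c, d), (e, f))" by (metis surj_pair)
    show "w \<in> ?up ` topped n (k - 1) \<union> spanning n k"
    proof (cases "w \<in> spanning n k")
      case False
      then have "((a, b - 1), (c, d - 1), (e, f - 1)) \<in> topped n (k - 1)"
        using w by (auto simp: weq topped_def spanning_def configs_def isosceles_at_def)
      then have "?up ((a, b - 1), (c, d - 1), (e, f - 1)) \<in> ?up ` topped n (k - 1)"
        by (rule imageI)
      then show ?thesis by (simp add: weq)
    qed simp
  next
    fix w assume "w \<in> ?up ` topped n (k - 1) \<union> spanning n k"
    then show "w \<in> topped n k"
      using assms by (auto simp: topped_def spanning_def configs_def isosceles_at_def)
  qed
  moreover have "?up ` topped n (k - 1) \<inter> spanning n k = {}"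
    by (auto simp: topped_def spanning_def configs_def)
  ultimately have "card (topped n k) = card (?up ` topped n (k - 1)) + card (spanning n k)"
    using finite_topped finite_spanning by (simp add: card_Un_disjoint)
  then show ?thesis by (simp add: card_image[OF inj])
qed

definition balanced :: "int \<Rightarrow> int \<Rightarrow> (pt \<times> pt \<times> pt) set" where
  "balanced n k = {(x, y, z) \<in> spanning n k. \<bar>snd y - snd x\<bar> = \<bar>snd z - snd x\<bar>}"

definition steep :: "int \<Rightarrow> int \<Rightarrow> (pt \<times> pt \<times> pt) set" where
  "steep n k = {(x, y, z) \<in> spanning n k. \<bar>snd y - snd x\<bar> > \<bar>snd z - snd x\<bar>}"

lemma card_spanning: "card (spanning n k) = card (balanced n k) + 2 * card (steep n k)"
proof -
  let ?sw = "\<lambda>(x, y, z). (x, z, y) :: pt \<times> pt \<times> pt"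
  have mem: "(x, z, y) \<in> spanning n k \<longleftrightarrow> (x, y, z) \<in> spanning n k" for x y z
    using isosceles_at_swap[of x y z] by (auto simp: spanning_def topped_def configs_def)
  have fin: "finite (balanced n k)" "finite (steep n k)"
    by (rule finite_subset[OF _ finite_spanning[of n k]], force simp: balanced_def steep_def)+
  have "spanning n k = balanced n k \<union> (steep n k \<union> ?sw ` steep n k)"
  proof (intro equalityI subsetI)
    fix w assume w: "w \<in> spanning n k"
    obtain x y z where weq: "w = (x, y, z)" by (metis surj_pair)
    have "(x, z, y) \<in> spanning n k" using w mem by (simp add: weq)
    then have "w \<in> ?sw ` steep n k" if "\<bar>snd y - snd x\<bar> < \<bar>snd z - snd x\<bar>"
      using that by (force simp: weq steep_def)
    then show "w \<in> balanced n k \<union> (steep n k \<union> ?sw ` steep n k)"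
      using w by (fastforce simp: weq balanced_def steep_def)
  qed (auto simp: balanced_def steep_def mem)
  moreover have "balanced n k \<inter> (steep n k \<union> ?sw ` steep n k) = {}"
    "steep n k \<inter> ?sw ` steep n k = {}"
    by (auto simp: balanced_def steep_def)
  ultimately have "card (spanning n k)
      = card (balanced n k) + (card (steep n k) + card (?sw ` steep n k))"
    using fin by (simp add: card_Un_disjoint)
  moreover have "card (?sw ` steep n k) = card (steep n k)"
    by (rule card_image) (auto simp: inj_on_def)
  ultimately show ?thesis by simp
qed

section \<open>Balanced triangles\<close>

text \<open>
  Legs with equal rises have equal runs, so they are mirror images of each other in an
  axis direction; the point reflection is excluded because it gives collinear points.
\<close>

lemma isosceles_at_balanced_iff:
  assumes "\<bar>d - b\<bar> = \<bar>f - b\<bar>"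
  shows "isosceles_at (a, b) (c, d) (e, f) \<longleftrightarrow>
    a \<noteq> c \<and> b \<noteq> d \<and> (d = f \<and> c - a = a - e \<or> d - b = b - f \<and> c = e)"
proof
  assume "isosceles_at (a, b) (c, d) (e, f)"
  then have sq: "(c - a)\<^sup>2 + (d - b)\<^sup>2 = (e - a)\<^sup>2 + (f - b)\<^sup>2"
    and cr: "(c - a) * (f - b) - (d - b) * (e - a) \<noteq> 0"
    by (auto simp: isosceles_at_def)
  have "(d - b)\<^sup>2 = (f - b)\<^sup>2" using assms by (metis power2_abs)
  with sq have "\<bar>c - a\<bar> = \<bar>e - a\<bar>" by (simp add: power2_eq_iff abs_eq_iff)
  then consider "c - a = e - a" | "c - a = - (e - a)" by linarith
  then show "a \<noteq> c \<and> b \<noteq> d \<and> (d = f \<and> c - a = a - e \<or> d - b = b - f \<and> c = e)"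
  proof cases
    case 1
    with assms cr show ?thesis by (auto simp: abs_eq_iff algebra_simps)
  next
    case 2
    then have c: "c = 2 * a - e" by simp
    from assms consider "d = f" | "d = 2 * b - f" by (auto simp: abs_eq_iff)
    then show ?thesis
      using cr unfolding c by cases (auto simp: algebra_simps)
  qed
next
  assume "a \<noteq> c \<and> b \<noteq> d \<and> (d = f \<and> c - a = a - e \<or> d - b = b - f \<and> c = e)"
  then have ne: "c - a \<noteq> 0" "d - b \<noteq> 0"
    and "(f - b = d - b \<and> e - a = - (c - a)) \<or> (f - b = - (d - b) \<and> e - a = c - a)"
    by auto
  then show "isosceles_at (a, b) (c, d) (e, f)"
    unfolding isosceles_at_def sqdist.simps cross.simps by (elim disjE) (simp_all add: power2_commute)
qed

lemma balanced_iff: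
  assumes "k \<ge> 2"
  shows "((a, b), (c, d), (e, f)) \<in> balanced n k \<longleftrightarrow>
    {a, c, e} \<subseteq> {1..n} \<and> a \<noteq> c \<and>
    (((b = 1 \<and> d = k \<and> f = k) \<or> (b = k \<and> d = 1 \<and> f = 1)) \<and> c - a = a - e \<or>
     2 * b = k + 1 \<and> ((d = 1 \<and> f = k) \<or> (d = k \<and> f = 1)) \<and> c = e)"
    (is "_ \<longleftrightarrow> ?R")
proof -
  have "((a, b), (c, d), (e, f)) \<in> balanced n k \<longleftrightarrow>
    {a, c, e} \<subseteq> {1..n} \<and> {b, d, f} \<subseteq> {1..k} \<and> k \<in> {b, d, f} \<and> 1 \<in> {b, d, f} \<and>
    \<bar>d - b\<bar> = \<bar>f - b\<bar> \<and>
    a \<noteq> c \<and> b \<noteq> d \<and> (d = f \<and> c - a = a - e \<or> d - b = b - f \<and> c = e)"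
    using isosceles_at_balanced_iff[of d b f a c e]
    by (auto simp: balanced_def spanning_def topped_def configs_def)
  also have "\<dots> \<longleftrightarrow> ?R"
    using assms by (simp; smt (verit))
  finally show ?thesis .
qed

text \<open>
  The bottom row stays, the top row moves up by two and everything between moves up by one. An
  apex that is not in an extreme row is halfway between them, so it stays halfway.
\<close>

lemma card_balanced_step:
  assumes "k \<ge> 4"
  shows "card (balanced n k) = card (balanced n (k - 2))"
proof -
  define g where "g r = (if r = 1 then 1 else if r = k - 2 then k else r + 1)" for r
  define g' where "g' r = (if r = 1 then 1 else if r = k then k - 2 else r - 1)" for r
  let ?G = "\<lambda>h ((a, b), (c, d), (e, f)). ((a, h b), (c, h d), (e, h f)) :: pt \<times> pt \<times> pt"
  have "bij_betw (?G g) (balanced n (k - 2)) (balanced n k)"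
  proof (rule bij_betw_byWitness[where f' = "?G g'"])
    show "\<forall>w\<in>balanced n (k - 2). ?G g' (?G g w) = w"
      using assms by (auto simp: balanced_iff g_def g'_def)
    show "\<forall>w\<in>balanced n k. ?G g (?G g' w) = w"
      using assms by (auto simp: balanced_iff g_def g'_def)
    show "?G g ` balanced n (k - 2) \<subseteq> balanced n k"
      using assms by (auto simp: balanced_iff g_def)
    show "?G g' ` balanced n k \<subseteq> balanced n (k - 2)"
      using assms by (auto simp: balanced_iff g'_def)
  qed
  then show ?thesis by (simp add: bij_betw_same_card)
qed

section \<open>Steep triangles\<close>

text \<open>
  This plays two roles: it is the deficit of the extremal height from \<open>m^2\<close>, and it is the
  horizontal run of the steeper leg in the triangles of that height.
\<close>

definition offset :: "int \<Rightarrow> int" where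
  "offset m = (if odd m then 0 else 1)"

text \<open>
  A factor \<open>p - q \<ge> 2\<close> would make \<open>p + q\<close> at most half of \<open>m^2\<close>. So \<open>p - q = 1\<close> and \<open>p + q\<close> is an odd
  difference of squares between \<open>m^2 - 1\<close> and \<open>m^2\<close>, which forces the larger square to be \<open>m^2\<close>.
\<close>

lemma steep_arith:
  fixes p q A B m :: int
  assumes "m \<ge> 1" "0 \<le> q" "q < p" "0 \<le> B" "0 \<le> A" "A \<le> m"
    and eq: "(p - q) * (p + q) = A\<^sup>2 - B\<^sup>2"
    and ge: "p + q \<ge> m\<^sup>2 - offset m"
  shows "p = q + 1 \<and> p + q = m\<^sup>2 - offset m \<and> A = m \<and> B = offset m"
proof -
  have m2: "odd m \<and> 1 \<le> m\<^sup>2 \<or> even m \<and> 2 \<le> m \<and> 4 \<le> m\<^sup>2"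
  proof (cases "even m")
    case True
    then have "2 \<le> m" using assms(1) by presburger
    then show ?thesis using True power_mono[of 2 m 2] by simp
  qed (use assms(1) in simp)
  have A2: "A\<^sup>2 \<le> m\<^sup>2" using assms by (simp add: power_mono)
  have B2: "0 \<le> B\<^sup>2" by simp
  have "\<not> 2 \<le> p - q"
  proof
    assume "2 \<le> p - q"
    then have "2 * (p + q) \<le> (p - q) * (p + q)" using assms by (intro mult_right_mono) auto
    then have "2 * (p + q) \<le> m\<^sup>2" using A2 B2 eq by linarith
    then show False using m2 ge unfolding offset_def by (elim disjE) simp_all
  qed
  then have p: "p = q + 1" using assms by simp
  then have sum: "2 * q + 1 = A\<^sup>2 - B\<^sup>2" using eq by simp
  show ?thesis
  proof (cases "odd m")
    case True
    then have "m\<^sup>2 \<le> A\<^sup>2 - B\<^sup>2" using sum p ge by (simp add: offset_def)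
    then have "A\<^sup>2 = m\<^sup>2" "B\<^sup>2 = 0" using A2 B2 by linarith+
    then have "A = m" "B = 0" using assms by (auto simp: power2_eq_iff)
    then show ?thesis using True p sum by (simp add: offset_def)
  next
    case False
    then have "even (m\<^sup>2)" "2 \<le> m" using m2 by auto
    have "m\<^sup>2 - 1 \<le> 2 * q + 1" "2 * q + 1 \<le> m\<^sup>2"
      using sum p ge A2 B2 False unfolding offset_def by (simp_all, linarith)
    moreover have "m\<^sup>2 \<noteq> 2 * q + 1"
    proof
      assume "m\<^sup>2 = 2 * q + 1"
      with \<open>even (m\<^sup>2)\<close> have "even (2 * q + 1)" by argo
      then show False by simp
    qed
    ultimately have q: "2 * q + 1 = m\<^sup>2 - 1" by linarith
    have "A = m"
    proof (rule ccontr)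
      assume "A \<noteq> m"
      then have "A\<^sup>2 \<le> (m - 1)\<^sup>2" using assms by (intro power_mono) auto
      also have "(m - 1)\<^sup>2 = m\<^sup>2 - 2 * m + 1" by (simp add: power2_diff)
      finally show False using q sum B2 \<open>2 \<le> m\<close> by linarith
    qed
    then have "B\<^sup>2 = 1" using q sum by simp
    then have "B = 1" using assms by (simp add: power2_eq_1_iff)
    then show ?thesis using False p q \<open>A = m\<close> by (simp add: offset_def)
  qed
qed

text \<open>
  The three rows are the apex row and the rows at distance \<open>\<bar>d - b\<bar>\<close> and \<open>\<bar>f - b\<bar>\<close> from it, so a
  triple that spans the rows \<open>1\<close> to \<open>k\<close> has rises of sum at least \<open>k - 1\<close>. This is what turns the
  bound on \<open>p + q\<close> into a bound on the height.
\<close>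

lemma steepD:
  assumes "((a, b), (c, d), (e, f)) \<in> steep n k" "n \<ge> 2" "k - 1 \<ge> (n - 1)\<^sup>2 - offset (n - 1)"
  shows "k - 1 = (n - 1)\<^sup>2 - offset (n - 1)" "\<bar>d - b\<bar> = \<bar>f - b\<bar> + 1" "\<bar>d - b\<bar> + \<bar>f - b\<bar> = k - 1"
    "\<bar>e - a\<bar> = n - 1" "\<bar>c - a\<bar> = offset (n - 1)"
proof -
  define p q A B where "p = \<bar>d - b\<bar>" "q = \<bar>f - b\<bar>" "A = \<bar>e - a\<bar>" "B = \<bar>c - a\<bar>"
  note defs = this
  have cols: "{a, c, e} \<subseteq> {1..n}" and rows: "{b, d, f} \<subseteq> {1..k}" "k \<in> {b, d, f}" "1 \<in> {b, d, f}"
    and iso: "(c - a)\<^sup>2 + (d - b)\<^sup>2 = (e - a)\<^sup>2 + (f - b)\<^sup>2" and "q < p"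
    using assms(1) by (auto simp: steep_def spanning_def topped_def configs_def isosceles_at_def defs)
  have ge: "p + q \<ge> k - 1" using rows unfolding defs by auto
  have "(p - q) * (p + q) = p\<^sup>2 - q\<^sup>2" by (simp add: power2_eq_square algebra_simps)
  also have "\<dots> = A\<^sup>2 - B\<^sup>2" using iso by (simp add: defs)
  finally have "p = q + 1 \<and> p + q = (n - 1)\<^sup>2 - offset (n - 1) \<and> A = n - 1 \<and> B = offset (n - 1)"
    using cols \<open>q < p\<close> ge assms(2,3) by (intro steep_arith) (auto simp: defs)
  then show "k - 1 = (n - 1)\<^sup>2 - offset (n - 1)" "\<bar>d - b\<bar> = \<bar>f - b\<bar> + 1" "\<bar>d - b\<bar> + \<bar>f - b\<bar> = k - 1"
    "\<bar>e - a\<bar> = n - 1" "\<bar>c - a\<bar> = offset (n - 1)"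
    using ge assms(3) by (simp_all add: defs)
qed

lemma steep_empty:
  assumes "n \<ge> 2" "k - 1 > (n - 1)\<^sup>2 - offset (n - 1)"
  shows "steep n k = {}"
  using steepD(1)[OF _ assms(1)] assms(2) by fastforce

text \<open>
  At the extremal height the flatter leg runs across the whole width, so the apex is in an extreme
  column, and the legs go to opposite sides of the apex row (or \<open>q = 0\<close>), so the feet are in the
  extreme rows. Choosing the column of the apex and which foot is on top leaves four triples.
\<close>

lemma card_steep_critical:
  assumes "n \<ge> 2" "k - 1 = (n - 1)\<^sup>2 - offset (n - 1)"
  shows "card (steep n k) = 4"
proof -
  define m \<epsilon> where "m = n - 1" "\<epsilon> = offset m"
  note defs = this
  have h: "k - 1 = m\<^sup>2 - \<epsilon>" and "m \<ge> 1" using assms by (auto simp: defs)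
  have \<epsilon>: "0 \<le> \<epsilon>" "\<epsilon> \<le> m" "\<epsilon>\<^sup>2 = \<epsilon>" using \<open>m \<ge> 1\<close> by (auto simp: defs offset_def)
  \<comment> \<open>The offset is chosen so that the height is odd; it is the sum \<open>(q + 1) + q\<close> of the rises.\<close>
  have "odd (k - 1)" unfolding h by (auto simp: defs offset_def)
  then obtain q where q: "k - 1 = 2 * q + 1" by (elim oddE)
  have "k - 1 \<ge> 0"
    using \<open>m \<ge> 1\<close> unfolding h by (auto simp: defs offset_def)
  then have "q \<ge> 0" using q by presburger
  let ?E = "{((1, q + 1), (1 + \<epsilon>, k), (n, 1)), ((1, q + 2), (1 + \<epsilon>, 1), (n, k)),
             ((n, q + 1), (n - \<epsilon>, k), (1, 1)), ((n, q + 2), (n - \<epsilon>, 1), (1, k))}"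
  have "steep n k = ?E"
  proof (intro equalityI subsetI)
    fix w assume w: "w \<in> steep n k"
    obtain a b c d e f where weq: "w = ((a, b), (c, d), (e, f))" by (metis surj_pair)
    have D: "\<bar>d - b\<bar> = \<bar>f - b\<bar> + 1" "\<bar>d - b\<bar> + \<bar>f - b\<bar> = k - 1" "\<bar>e - a\<bar> = n - 1" "\<bar>c - a\<bar> = \<epsilon>"
      using steepD[OF w[unfolded weq] assms(1)] assms(2) by (auto simp: defs)
    have cols: "{a, c, e} \<subseteq> {1..n}" and rows: "{b, d, f} \<subseteq> {1..k}" "k \<in> {b, d, f}" "1 \<in> {b, d, f}"
      using w by (auto simp: weq steep_def spanning_def topped_def configs_def)
    have "a = 1 \<and> c = 1 + \<epsilon> \<and> e = n \<or> a = n \<and> c = n - \<epsilon> \<and> e = 1"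
      using cols D(3,4) by auto
    moreover have "b = q + 1 \<and> d = k \<and> f = 1 \<or> b = q + 2 \<and> d = 1 \<and> f = k"
    proof -
      have "\<bar>f - b\<bar> = q" "\<bar>d - b\<bar> = q + 1" "k = 2 * q + 2" using D(1,2) q by auto
      then consider "f = b + q" "d = b + q + 1" | "f = b + q" "d = b - q - 1"
        | "f = b - q" "d = b + q + 1" | "f = b - q" "d = b - q - 1" by linarith
      then show ?thesis
        using rows \<open>k = 2 * q + 2\<close> \<open>q \<ge> 0\<close> by cases auto
    qed
    ultimately show "w \<in> ?E" by (auto simp: weq)
  next
    fix w assume w: "w \<in> ?E"
    have "m \<ge> \<epsilon>" "n = m + 1" "k = 2 * q + 2" "2 * q + 1 = m\<^sup>2 - \<epsilon>" using q h \<epsilon> by (auto simp: defs)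
    have sq: "\<epsilon>\<^sup>2 + (q + 1)\<^sup>2 = m\<^sup>2 + q\<^sup>2"
      using \<open>2 * q + 1 = m\<^sup>2 - \<epsilon>\<close> \<epsilon>(3) by (simp add: power2_sum)
    have pos: "\<epsilon> * q + (q + 1) * m > 0"
      using \<open>q \<ge> 0\<close> \<open>m \<ge> 1\<close> \<epsilon> by (intro add_nonneg_pos mult_pos_pos mult_nonneg_nonneg) auto
    have neg: "(- 1 - q)\<^sup>2 = (1 + q)\<^sup>2"
      by (simp add: power2_eq_square algebra_simps)
    show "w \<in> steep n k"
      using w sq neg pos \<open>q \<ge> 0\<close> \<open>m \<ge> 1\<close> \<epsilon>(1,2) unfolding \<open>n = m + 1\<close> \<open>k = 2 * q + 2\<close>
      by (auto simp: steep_def spanning_def topped_def configs_def isosceles_at_def algebra_simps)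
  qed
  moreover have "card ?E = 4" using assms(1) q \<open>q \<ge> 0\<close> by auto
  ultimately show ?thesis by simp
qed

section \<open>The recurrence\<close>

text \<open>
  Every steep triple has a twin with the feet exchanged that is not steep, which compensates the
  factor two between triples and triangles; so the defect is the difference of steep counts itself.
\<close>

lemma recurrence_defect:
  assumes "k \<ge> 4"
  shows "a_int n k - 2 * a_int n (k - 1) + 2 * a_int n (k - 3) - a_int n (k - 4)
    = int (card (steep (int n) (int k))) - int (card (steep (int n) (int k - 2)))"
proof -
  let ?c = "\<lambda>j. int (card (configs (int n) j))"
  let ?b = "\<lambda>j. int (card (topped (int n) j))"
  have c: "2 * a_int n (k - j) = ?c (int k - int j)" if "j \<le> 4" for j
    using card_configs[of n "k - j"] that assms by (simp add: of_nat_diff)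
  have "?c (int k) = ?c (int k - 1) + ?b (int k)"
    "?c (int k - 1) = ?c (int k - 2) + ?b (int k - 1)"
    "?c (int k - 2) = ?c (int k - 3) + ?b (int k - 2)"
    "?c (int k - 3) = ?c (int k - 4) + ?b (int k - 3)"
    using card_configs_diff[of "int n" "int k"] card_configs_diff[of "int n" "int k - 1"]
      card_configs_diff[of "int n" "int k - 2"] card_configs_diff[of "int n" "int k - 3"] by simp_all
  moreover have "?b (int k) - ?b (int k - 1) = int (card (spanning (int n) (int k)))"
    "?b (int k - 2) - ?b (int k - 3) = int (card (spanning (int n) (int k - 2)))"
    using card_topped_diff[of "int k" "int n"] card_topped_diff[of "int k - 2" "int n"] assms by simp_all
  ultimately have "?c (int k) - 2 * ?c (int k - 1) + 2 * ?c (int k - 3) - ?c (int k - 4)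
      = int (card (spanning (int n) (int k))) - int (card (spanning (int n) (int k - 2)))"
    by linarith
  also have "\<dots> = 2 * (int (card (steep (int n) (int k))) - int (card (steep (int n) (int k - 2))))"
    using card_balanced_step[of "int k" "int n"] assms by (simp add: card_spanning)
  finally show ?thesis
    using c[of 0] c[of 1] c[of 3] c[of 4] by simp
qed

theorem mainTheorem3:
  fixes n :: nat
  assumes "n \<ge> 2"
  shows "(recurrence_beyond n (int (K_bound n)) \<and>
          (\<forall>K::int. recurrence_beyond n K \<longrightarrow> int (K_bound n) \<le> K)) \<and>
         (let k = K_bound n in
            a_int n k = 2 * a_int n (k - 1) - 2 * a_int n (k - 3) + a_int n (k - 4) - 4)"
proof -
  let ?K = "K_bound n"
  have n: "int n \<ge> 2" using assms by simp
  have K: "int ?K = (int n - 1)\<^sup>2 - offset (int n - 1) + 3"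
    using assms by (auto simp: K_bound_def offset_def of_nat_diff)
  have "?K \<ge> 4"
  proof (cases "n = 2")
    case False
    then have "2\<^sup>2 \<le> (n - 1)\<^sup>2" using assms by (intro power_mono) auto
    then show ?thesis by (simp add: K_bound_def)
  qed (simp add: K_bound_def)
  have at_K: "a_int n ?K = 2 * a_int n (?K - 1) - 2 * a_int n (?K - 3) + a_int n (?K - 4) - 4"
    using recurrence_defect[OF \<open>?K \<ge> 4\<close>, of n] card_steep_critical[OF n, of "int ?K - 2"]
      steep_empty[OF n, of "int ?K"] K by simp
  have "recurrence_beyond n (int ?K)"
    unfolding recurrence_beyond_def
  proof (intro allI impI, elim conjE)
    fix k :: nat assume k: "4 \<le> k" "int ?K < int k"
    show "a_int n k = 2 * a_int n (k - 1) - 2 * a_int n (k - 3) + a_int n (k - 4)"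
      using recurrence_defect[OF k(1), of n] steep_empty[OF n, of "int k"]
        steep_empty[OF n, of "int k - 2"] k(2) K by simp
  qed
  moreover have "int ?K \<le> K" if "recurrence_beyond n K" for K
  proof (rule ccontr)
    assume "\<not> int ?K \<le> K"
    then have "a_int n ?K = 2 * a_int n (?K - 1) - 2 * a_int n (?K - 3) + a_int n (?K - 4)"
      using that \<open>?K \<ge> 4\<close> unfolding recurrence_beyond_def by simp
    with at_K show False by simp
  qed
  ultimately show ?thesis using at_K by (simp add: Let_def)
qed

end
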